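(* Let $G=(V,E)$ be a directed graph on $n$ vertices and $m$ edges with positive real capacities, a designated source vertex $s$ and a designated sink vertex $t$. There is a structure $\mathcal{S}_{vit}(G)$ of total size $\mathcal{O}(mn)$ consisting of $\mathcal{O}(n)$ directed acyclic graphs, each of whose node sets is a partition of $V$ (with $s$ and $t$ in distinct nodes), such that for every vital edge $e$ of $G$: (1) there exist at most two of these DAGs, $\mathcal{D}^s(e)$ and $\mathcal{D}^t(e)$, that store all mincuts for $e$; and (2) an $(s,t)$-cut $C$ of $G$ is a mincut for $e$ if and only if $C$ is (a union of nodes forming) a $1$-transversal cut in $\mathcal{D}^s(e)$ or in $\mathcal{D}^t(e)$ and $e$ is a contributing edge of $C$.
   Context: An $(s,t)$-cut is a set $C\subset V$ with $s\in C$, $t\notin C$; an edge $(x,y)$ contributes to $C$ if $x\in C$, $y\notin C$; $c(C)$ is the total capacity of contributing edges. An edge is vital if its removal strictly decreases the minimum $(s,t)$-cut capacity. A mincut for edge $e$ is an $(s,t)$-cut to which $e$ contributes of minimum capacity among all $(s,t)$-cuts to which $e$ contributes. In a DAG $D$ whose nodes partition $V$, a cut is a set of nodes containing the node of $s$ but not that of $t$; its edge-set is the set of edges of $D$ with exactly one endpoint in it; it is $1$-transversal if its edge-set intersects every simple path of $D$ in at most one edge. A DAG stores a cut $C$ of $G$ if $C$ is a union of its nodes. *)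

theory Defs
  imports Complex_Main "Graph_Theory.Graph_Theory" "HOL-Library.Disjoint_Sets"
begin

definition st_cut :: "('a, 'b) pre_digraph \<Rightarrow> 'a \<Rightarrow> 'a \<Rightarrow> 'a set \<Rightarrow> bool" where
  "st_cut G s t C \<longleftrightarrow> C \<subseteq> verts G \<and> s \<in> C \<and> t \<notin> C"

definition contributing :: "('a, 'b) pre_digraph \<Rightarrow> 'a set \<Rightarrow> 'b set" where
  "contributing G C = {e \<in> arcs G. tail G e \<in> C \<and> head G e \<notin> C}"

definition cut_capacity :: "('a, 'b) pre_digraph \<Rightarrow> ('b \<Rightarrow> real) \<Rightarrow> 'a set \<Rightarrow> real" where
  "cut_capacity G c C = (\<Sum>e\<in>contributing G C. c e)"

definition mincut_capacity :: "('a, 'b) pre_digraph \<Rightarrow> ('b \<Rightarrow> real) \<Rightarrow> 'a \<Rightarrow> 'a \<Rightarrow> real" where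
  "mincut_capacity G c s t = Min (cut_capacity G c ` {C. st_cut G s t C})"

definition vital :: "('a, 'b) pre_digraph \<Rightarrow> ('b \<Rightarrow> real) \<Rightarrow> 'a \<Rightarrow> 'a \<Rightarrow> 'b \<Rightarrow> bool" where
  "vital G c s t e \<longleftrightarrow>
     e \<in> arcs G \<and> mincut_capacity (pre_digraph.del_arc G e) c s t < mincut_capacity G c s t"

definition mincut_for ::
  "('a, 'b) pre_digraph \<Rightarrow> ('b \<Rightarrow> real) \<Rightarrow> 'a \<Rightarrow> 'a \<Rightarrow> 'b \<Rightarrow> 'a set \<Rightarrow> bool" where
  "mincut_for G c s t e C \<longleftrightarrow>
     st_cut G s t C \<and> e \<in> contributing G C \<and>
     (\<forall>C'. st_cut G s t C' \<and> e \<in> contributing G C' \<longrightarrow> cut_capacity G c C \<le> cut_capacity G c C')"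

definition partition_dag ::
  "('a, 'b) pre_digraph \<Rightarrow> 'a \<Rightarrow> 'a \<Rightarrow> 'a set pair_pre_digraph \<Rightarrow> bool" where
  "partition_dag G s t D \<longleftrightarrow>
     pair_fin_digraph D \<and> acyclic (parcs D) \<and> partition_on (verts G) (pverts D) \<and>
     \<not> (\<exists>X\<in>pverts D. s \<in> X \<and> t \<in> X)"

(* Space used by a DAG: every node with the list of the vertices it contains, and every edge. *)
definition dag_size :: "'a set pair_pre_digraph \<Rightarrow> nat" where
  "dag_size D = card (pverts D) + (\<Sum>X\<in>pverts D. card X) + card (parcs D)"

definition stores :: "'a set pair_pre_digraph \<Rightarrow> 'a set \<Rightarrow> bool" where
  "stores D C \<longleftrightarrow> (\<exists>N \<subseteq> pverts D. C = \<Union>N)"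

definition dag_cut :: "'a set pair_pre_digraph \<Rightarrow> 'a \<Rightarrow> 'a \<Rightarrow> 'a set set \<Rightarrow> bool" where
  "dag_cut D s t N \<longleftrightarrow> N \<subseteq> pverts D \<and> (\<exists>X\<in>N. s \<in> X) \<and> \<not> (\<exists>X\<in>N. t \<in> X)"

(* Unlike the contributing edges of a cut of G, edges of both directions are counted here. *)
definition dag_edge_set :: "'a set pair_pre_digraph \<Rightarrow> 'a set set \<Rightarrow> ('a set \<times> 'a set) set" where
  "dag_edge_set D N = {(X, Y) \<in> parcs D. (X \<in> N) \<noteq> (Y \<in> N)}"

definition one_transversal :: "'a set pair_pre_digraph \<Rightarrow> 'a set set \<Rightarrow> bool" where
  "one_transversal D N \<longleftrightarrow>
     (\<forall>X p Y. pre_digraph.apath (with_proj D) X p Y \<longrightarrow> card (set p \<inter> dag_edge_set D N) \<le> 1)"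

definition one_transversal_cut :: "'a set pair_pre_digraph \<Rightarrow> 'a \<Rightarrow> 'a \<Rightarrow> 'a set \<Rightarrow> bool" where
  "one_transversal_cut D s t C \<longleftrightarrow> (\<exists>N. dag_cut D s t N \<and> one_transversal D N \<and> C = \<Union>N)"

end

theory Submission
  imports Defs
begin

text \<open>
  Uncrossing shows that a mincut \<open>C\<close> for a vital edge is consistent: no vital edge enters \<open>C\<close>. Hence
  if \<open>weight e\<close> denotes the capacity of a mincut for \<open>e\<close>, a consistent cut of capacity less than
  \<open>l\<close> separates no two vertices that are connected by vital edges of weight at least \<open>l\<close>.

  Let \<open>e\<close> be vital of weight \<open>l\<close>, let \<open>W\<close> be the component of \<open>e\<close> under the vital edges of weight
  at least \<open>l\<close>, and fix a root \<open>r\<close> of \<open>W\<close>. The endpoints of \<open>e\<close> lie in components under the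
  vital edges of weight more than \<open>l\<close>, with roots \<open>u\<close> and \<open>v\<close>. A mincut for \<open>e\<close> contains \<open>u\<close> and
  avoids \<open>v\<close>. If it avoids \<open>r\<close>, it is one of the minimum consistent cuts with \<open>u\<close> inside and
  \<open>r\<close> outside, otherwise it is one of those with \<open>r\<close> inside and \<open>v\<close> outside. Both families are
  lattices, and each lattice is stored by one DAG of size \<open>O(m + n)\<close>. Since every vertex stops being a root only once
  as \<open>l\<close> decreases, \<open>O(n)\<close> DAGs suffice; only endpoints of vital edges occur as \<open>u\<close> and \<open>v\<close>, so
  there are also only \<open>O(m)\<close> of them, which gives the bound \<open>O(m n)\<close> even if \<open>m < n\<close>.
\<close>

subsection \<open>The DAG of a family of sets\<close>

definition sig :: "'a set set \<Rightarrow> 'a \<Rightarrow> 'a set set" where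
  "sig F v = {C \<in> F. v \<in> C}"

definition sig_class :: "'a set \<Rightarrow> 'a set set \<Rightarrow> 'a \<Rightarrow> 'a set" where
  "sig_class V F v = {u \<in> V. sig F u = sig F v}"

text \<open>The nodes are the classes of vertices that no member of \<open>F\<close> separates. An
  arc records a strict implication "every member containing \<open>u\<close> contains
  \<open>v\<close>", so arcs may enter a member but never leave it. Only pairs in \<open>A\<close>
  are recorded, which bounds the number of arcs.\<close>

definition family_dag :: "'a set \<Rightarrow> ('a \<times> 'a) set \<Rightarrow> 'a set set \<Rightarrow> 'a set pair_pre_digraph" where
  "family_dag V A F =
     \<lparr> pverts = sig_class V F ` V,
       parcs = (\<lambda>(u, v). (sig_class V F u, sig_class V F v)) ` {(u, v) \<in> A. sig F u \<subset> sig F v} \<rparr>"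

lemma family_dag_simps [simp]:
  "pverts (family_dag V A F) = sig_class V F ` V"
  "parcs (family_dag V A F) =
     (\<lambda>(u, v). (sig_class V F u, sig_class V F v)) ` {(u, v) \<in> A. sig F u \<subset> sig F v}"
  by (simp_all add: family_dag_def)

lemma sig_class_self: "v \<in> V \<Longrightarrow> v \<in> sig_class V F v"
  by (simp add: sig_class_def)

lemma sig_class_eqI: "sig F u = sig F v \<Longrightarrow> sig_class V F u = sig_class V F v"
  by (simp add: sig_class_def)

lemma sig_eqI: "x \<in> sig_class V F u \<Longrightarrow> sig F x = sig F u"
  by (simp add: sig_class_def)

lemma partition_on_sig_class: "partition_on V (sig_class V F ` V)"
proof (rule partition_onI)
  show "\<Union>(sig_class V F ` V) = V"
    by (auto simp: sig_class_def)
  show "{} \<notin> sig_class V F ` V"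
    using sig_class_self[of _ V F] by auto
  show "disjnt p q" if "p \<in> sig_class V F ` V" "q \<in> sig_class V F ` V" "p \<noteq> q" for p q
    using that by (auto simp: disjnt_def sig_class_def)
qed

lemma acyclic_family_dag:
  assumes "A \<subseteq> V \<times> V"
  shows "acyclic (parcs (family_dag V A F))"
\<comment> \<open>The members missing \<open>u\<close> strictly decrease along arcs. The measure
  must depend on the class and not on a representative; a member contains a class or is disjoint
  from it, hence the inclusion.\<close>
proof (rule acyclicI_order[where f = "\<lambda>X. {C \<in> F. \<not> X \<subseteq> C}"])
  have eq: "{C \<in> F. \<not> sig_class V F u \<subseteq> C} = F - sig F u" if "u \<in> V" for u
  proof -
    have "sig_class V F u \<subseteq> C \<longleftrightarrow> u \<in> C" if "C \<in> F" for C
      using \<open>u \<in> V\<close> that by (auto simp: sig_class_def sig_def)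
    then show ?thesis
      by (auto simp: sig_def)
  qed
  fix X Y assume "(X, Y) \<in> parcs (family_dag V A F)"
  then obtain u v where uv: "(u, v) \<in> A" "sig F u \<subset> sig F v"
    "X = sig_class V F u" "Y = sig_class V F v"
    by auto
  have "F - sig F v \<subset> F - sig F u"
    using uv(2) by (auto simp: sig_def)
  moreover have "u \<in> V" "v \<in> V"
    using uv(1) assms by auto
  ultimately show "{C \<in> F. \<not> Y \<subseteq> C} < {C \<in> F. \<not> X \<subseteq> C}"
    by (simp only: uv(3,4) eq)
qed

lemma partition_dag_family_dag:
  assumes "finite (verts G)" "A \<subseteq> verts G \<times> verts G" "C \<in> F" "s \<in> C" "t \<notin> C"
  shows "partition_dag G s t (family_dag (verts G) A F)"
  unfolding partition_dag_def
proof (intro conjI)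
  let ?V = "verts G"
  have "finite A"
    using assms finite_subset by blast
  then have "finite {(u, v) \<in> A. sig F u \<subset> sig F v}"
    by (rule rev_finite_subset) auto
  then show "pair_fin_digraph (family_dag ?V A F)"
    using assms(1,2) by unfold_locales auto
  show "acyclic (parcs (family_dag ?V A F))"
    using assms(2) by (rule acyclic_family_dag)
  show "partition_on ?V (pverts (family_dag ?V A F))"
    by (simp add: partition_on_sig_class)
  have "sig F s \<noteq> sig F t"
    using assms(3-5) by (auto simp: sig_def)
  then show "\<not> (\<exists>X\<in>pverts (family_dag ?V A F). s \<in> X \<and> t \<in> X)"
    by (auto simp: sig_class_def)
qed

lemma dag_size_family_dag:
  assumes "finite V" "finite A"
  shows "dag_size (family_dag V A F) \<le> 2 * card V + card A"
proof -
  have "card (sig_class V F ` V) \<le> card V"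
    by (rule card_image_le[OF assms(1)])
  moreover have "(\<Sum>X\<in>sig_class V F ` V. card X) = card V"
    by (rule product_partition[OF partition_on_sig_class, symmetric])
      (auto simp: sig_class_def assms(1))
  moreover have "finite {(u, v) \<in> A. sig F u \<subset> sig F v}"
    using assms(2) by (rule rev_finite_subset) auto
  then have "card (parcs (family_dag V A F)) \<le> card {(u, v) \<in> A. sig F u \<subset> sig F v}"
    by (simp only: family_dag_simps card_image_le)
  moreover have "card {(u, v) \<in> A. sig F u \<subset> sig F v} \<le> card A"
    by (rule card_mono[OF assms(2)]) auto
  ultimately show ?thesis
    unfolding dag_size_def by simp
qed

section \<open>1-transversal cuts of the DAG of a family\<close>

lemma stores_if_one_transversal_cut: "one_transversal_cut D s t C \<Longrightarrow> stores D C"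
  by (auto simp: one_transversal_cut_def stores_def dag_cut_def)

text \<open>A path that has entered \<open>N\<close> can never leave it again, so it crosses the
  boundary at most once.\<close>

lemma one_transversal_if_closed:
  assumes "\<And>X Y. (X, Y) \<in> parcs D \<Longrightarrow> X \<in> N \<Longrightarrow> Y \<in> N"
  shows "one_transversal D N"
proof -
  have inside: "set p \<inter> dag_edge_set D N = {}" if "pcas X p Y" "set p \<subseteq> parcs D" "X \<in> N" for X p Y
    using that assms by (induction p arbitrary: X) (fastforce simp: dag_edge_set_def)+
  have "card (set p \<inter> dag_edge_set D N) \<le> 1" if "pcas X p Y" "set p \<subseteq> parcs D" for X p Y
    using that
  proof (induction p arbitrary: X)
    case (Cons e p)
    show ?case
    proof (cases "e \<in> dag_edge_set D N")
      case True
      then have "snd e \<in> N"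
        using assms by (auto simp: dag_edge_set_def)
      then have "set p \<inter> dag_edge_set D N = {}"
        using Cons.prems inside[of "snd e" p Y] by simp
      then show ?thesis
        using True by simp
    next
      case False
      then show ?thesis
        using Cons.IH[of "snd e"] Cons.prems by simp
    qed
  qed simp
  then show ?thesis
    unfolding one_transversal_def
    by (auto simp: pre_digraph.apath_def pre_digraph.awalk_def cas_with_proj_eq)
qed

text \<open>A member of \<open>F\<close> is a union of classes, and by the choice of the arcs these
  classes are closed under successors.\<close>

lemma one_transversal_cut_family_dag:
  assumes "C \<in> F" "C \<subseteq> V" "A \<subseteq> V \<times> V" "s \<in> C" "t \<notin> C"
  shows "one_transversal_cut (family_dag V A F) s t C"
  unfolding one_transversal_cut_def
proof (intro exI conjI)
  let ?N = "sig_class V F ` C"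
  have sub: "sig_class V F u \<subseteq> C" if "u \<in> C" for u
    using that assms(1) by (auto simp: sig_class_def sig_def)
  show union: "C = \<Union>?N"
    using sub sig_class_self[of _ V F] assms(2) by blast
  show "dag_cut (family_dag V A F) s t ?N"
    using sub assms(2,4,5) sig_class_self[of s V F] by (fastforce simp: dag_cut_def)
  show "one_transversal (family_dag V A F) ?N"
  proof (rule one_transversal_if_closed)
    fix X Y assume "(X, Y) \<in> parcs (family_dag V A F)" "X \<in> ?N"
    then obtain u v where uv: "(u, v) \<in> A" "sig F u \<subset> sig F v"
      "X = sig_class V F u" "Y = sig_class V F v"
      by auto
    have "u \<in> C"
      using uv(1,3) assms(3) \<open>X \<in> ?N\<close> union sig_class_self[of u V F] by blast
    then have "v \<in> C"
      using uv(2) assms(1) by (auto simp: sig_def)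
    then show "Y \<in> ?N"
      using uv(4) by simp
  qed
qed

text \<open>An arc of the DAG leaving the cut could be preceded by an arc from the class of \<open>t\<close>, which
  would enter the cut, so that the path through both is crossed twice.\<close>

lemma closed_if_one_transversal_cut:
  assumes cut: "one_transversal_cut (family_dag V A F) s t Z"
    and A: "A \<subseteq> V \<times> V" and t: "t \<in> V" "{t} \<times> V \<subseteq> A" "\<forall>C\<in>F. t \<notin> C"
    and uv: "(u, v) \<in> A" "u \<in> Z" "sig F u \<subseteq> sig F v"
  shows "v \<in> Z"
proof (rule ccontr)
  let ?D = "family_dag V A F" and ?c = "sig_class V F"
  assume "v \<notin> Z"
  obtain N where N: "dag_cut ?D s t N" "one_transversal ?D N" "Z = \<Union>N"
    using cut by (auto simp: one_transversal_cut_def)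
  have V: "u \<in> V" "v \<in> V"
    using A uv(1) by auto
  have cls: "?c w \<in> N \<longleftrightarrow> w \<in> Z" if w: "w \<in> V" for w
  proof
    assume "w \<in> Z"
    then obtain X where X: "X \<in> N" "w \<in> X"
      using N(3) by blast
    then obtain w' where "X = ?c w'"
      using N(1) by (auto simp: dag_cut_def)
    then show "?c w \<in> N"
      using X sig_eqI[of w V F w'] sig_class_eqI[of F w w' V] by simp
  qed (use N(3) w sig_class_self[of w V F] in blast)
  have "t \<notin> Z"
    using N(1,3) by (auto simp: dag_cut_def)
  have inout: "?c t \<notin> N" "?c u \<in> N" "?c v \<notin> N"
    using cls t(1) V uv(2) \<open>t \<notin> Z\<close> \<open>v \<notin> Z\<close> by auto
  have "sig F t = {}"
    using t(3) by (auto simp: sig_def)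
  have "sig F t \<noteq> sig F u" "sig F u \<noteq> sig F v"
    using inout sig_class_eqI by metis+
  then have less: "sig F t \<subset> sig F u" "sig F u \<subset> sig F v"
    using \<open>sig F t = {}\<close> uv(3) by auto
  have arcs: "(?c t, ?c u) \<in> parcs ?D" "(?c u, ?c v) \<in> parcs ?D"
    using less uv(1) t(2) V by (force intro!: image_eqI)+
  \<comment> \<open>A simple path needs three distinct nodes. The classes of \<open>t\<close> and
    \<open>v\<close> lie on the same side of the cut, so only their signatures tell them
    apart.\<close>
  have "sig F t \<noteq> sig F v"
    using less by auto
  then have "?c t \<noteq> ?c v"
    using t(1) sig_class_self[of t V F] sig_eqI[of t V F v] by auto
  let ?p = "[(?c t, ?c u), (?c u, ?c v)]"
  have "pre_digraph.apath (with_proj ?D) (?c t) ?p (?c v)"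
    using arcs inout \<open>?c t \<noteq> ?c v\<close> t(1)
    by (auto simp: pre_digraph.apath_def pre_digraph.awalk_def cas_with_proj_eq
        awalk_verts_with_proj_eq simp del: family_dag_simps(2))
  then have "card (set ?p \<inter> dag_edge_set ?D N) \<le> 1"
    using N(2) unfolding one_transversal_def by blast
  moreover have "set ?p \<inter> dag_edge_set ?D N = set ?p"
    using arcs inout by (auto simp: dag_edge_set_def simp del: family_dag_simps(2))
  moreover have "?c t \<noteq> ?c u"
    using inout by metis
  then have "card (set ?p) = 2"
    by simp
  ultimately show False
    by simp
qed

subsection \<open>Uncrossing and vital edges\<close>

text \<open>Only an arc joining \<open>X - Y\<close> and \<open>Y - X\<close> is counted once on the
  left and by neither union nor intersection. This error term stays explicit: it is large when
  mincuts are shown consistent, and empty in the exchange argument for the lattice.\<close>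

lemma cut_capacity_uncross:
  assumes "finite (arcs G)"
  shows "cut_capacity G c X + cut_capacity G c Y =
    cut_capacity G c (X \<union> Y) + cut_capacity G c (X \<inter> Y) +
    (\<Sum>e | e \<in> arcs G \<and> (tail G e \<in> X - Y \<and> head G e \<in> Y - X \<or>
                         tail G e \<in> Y - X \<and> head G e \<in> X - Y). c e)"
proof -
  have eq: "(\<Sum>e | e \<in> arcs G \<and> P e. c e) = (\<Sum>e\<in>arcs G. if P e then c e else 0)" for P
    using assms by (simp add: sum.inter_filter)
  show ?thesis
    unfolding cut_capacity_def contributing_def eq sum.distrib[symmetric]
    by (rule sum.cong) auto
qed

lemma cut_capacity_submodular:
  assumes "finite (arcs G)" "\<forall>e\<in>arcs G. 0 \<le> c e"
  shows "cut_capacity G c (X \<union> Y) + cut_capacity G c (X \<inter> Y)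
    \<le> cut_capacity G c X + cut_capacity G c Y"
proof -
  have "0 \<le> (\<Sum>e | e \<in> arcs G \<and> (tail G e \<in> X - Y \<and> head G e \<in> Y - X \<or>
                         tail G e \<in> Y - X \<and> head G e \<in> X - Y). c e)"
    using assms(2) by (intro sum_nonneg) auto
  then show ?thesis
    using cut_capacity_uncross[OF assms(1), of c X Y] by linarith
qed

lemma st_cut_Un: "st_cut G s t X \<Longrightarrow> st_cut G s t Y \<Longrightarrow> st_cut G s t (X \<union> Y)"
  and st_cut_Int: "st_cut G s t X \<Longrightarrow> st_cut G s t Y \<Longrightarrow> st_cut G s t (X \<inter> Y)"
  by (auto simp: st_cut_def)

section \<open>Vital edges and the capacities of their mincuts\<close>

locale st_network = fin_digraph G for G :: "('a, 'b) pre_digraph" +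
  fixes c :: "'b \<Rightarrow> real" and s t :: 'a
  assumes pos: "e \<in> arcs G \<Longrightarrow> 0 < c e"
    and s_in: "s \<in> verts G" and t_in: "t \<in> verts G" and s_neq_t: "s \<noteq> t"
begin

abbreviation "cap \<equiv> cut_capacity G c"

abbreviation "flow_value \<equiv> mincut_capacity G c s t"

lemma finite_st_cuts: "finite {C. st_cut G s t C}"
  by (rule finite_subset[of _ "Pow (verts G)"]) (auto simp: st_cut_def)

lemma flow_value_le: "st_cut G s t C \<Longrightarrow> flow_value \<le> cap C"
  unfolding mincut_capacity_def using finite_st_cuts by (auto intro!: Min_le)

lemma vital_arc: "vital G c s t e \<Longrightarrow> e \<in> arcs G"
  by (simp add: vital_def)

text \<open>Take a minimum cut after the removal of \<open>e\<close>. If \<open>e\<close> did not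
  contribute to it, it would have the same capacity in \<open>G\<close>, below
  \<open>flow_value\<close>.\<close>

lemma vital_cut:
  assumes "vital G c s t e"
  obtains C where "st_cut G s t C" "e \<in> contributing G C" "cap C < flow_value + c e"
proof -
  let ?G' = "del_arc e"
  have st: "st_cut ?G' s t C \<longleftrightarrow> st_cut G s t C" for C
    by (simp add: st_cut_def)
  have "{s} \<in> {C. st_cut ?G' s t C}"
    using s_in s_neq_t by (simp add: st_cut_def)
  moreover have "finite (cut_capacity ?G' c ` {C. st_cut ?G' s t C})"
    using finite_st_cuts by (simp add: st)
  ultimately have "mincut_capacity ?G' c s t \<in> cut_capacity ?G' c ` {C. st_cut ?G' s t C}"
    unfolding mincut_capacity_def by (intro Min_in) auto
  then obtain C where C: "st_cut G s t C" "cut_capacity ?G' c C < flow_value"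
    using assms by (auto simp: vital_def st)
  have contr: "contributing ?G' C = contributing G C - {e}"
    by (auto simp: contributing_def)
  have fin: "finite (contributing G C)"
    by (simp add: contributing_def)
  have "e \<in> contributing G C"
    using C flow_value_le[OF C(1)] contr
    by (cases "e \<in> contributing G C") (auto simp: cut_capacity_def)
  moreover from this have "cap C = cut_capacity ?G' c C + c e"
    using fin by (simp add: cut_capacity_def contr sum_diff1)
  ultimately show ?thesis
    using that C by simp
qed

text \<open>Junk unless some cut has \<open>e\<close> as a contributing edge.\<close>

definition weight :: "'b \<Rightarrow> real" where
  "weight e = Min (cap ` {C. st_cut G s t C \<and> e \<in> contributing G C})"

lemma weight_le:
  assumes "st_cut G s t C" "e \<in> contributing G C"
  shows "weight e \<le> cap C"
proof -
  have "finite {C. st_cut G s t C \<and> e \<in> contributing G C}"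
    using finite_st_cuts by (rule rev_finite_subset) auto
  then show ?thesis
    unfolding weight_def using assms by (auto intro!: Min_le)
qed

lemma weight_attained:
  assumes "vital G c s t e"
  obtains C where "st_cut G s t C" "e \<in> contributing G C" "cap C = weight e"
proof -
  let ?S = "{C. st_cut G s t C \<and> e \<in> contributing G C}"
  have "finite ?S"
    using finite_st_cuts by (rule rev_finite_subset) auto
  moreover have "?S \<noteq> {}"
    using vital_cut[OF assms] by blast
  ultimately have "weight e \<in> cap ` ?S"
    unfolding weight_def by (intro Min_in) auto
  then show ?thesis
    using that by auto
qed

lemma mincut_for_iff_weight:
  assumes "vital G c s t e"
  shows "mincut_for G c s t e C \<longleftrightarrow>
    st_cut G s t C \<and> e \<in> contributing G C \<and> cap C = weight e"
  using weight_attained[OF assms] weight_le unfolding mincut_for_def by (metis order_antisym)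

lemma weight_less: "vital G c s t e \<Longrightarrow> weight e < flow_value + c e"
  by (meson vital_cut weight_le order_le_less_trans)

lemma submodular: "cap (X \<union> Y) + cap (X \<inter> Y) \<le> cap X + cap Y"
  using pos by (intro cut_capacity_submodular) (auto intro: less_imp_le)

definition consistent :: "'a set \<Rightarrow> bool" where
  "consistent C \<longleftrightarrow> (\<forall>e. vital G c s t e \<longrightarrow> head G e \<in> C \<longrightarrow> tail G e \<in> C)"

lemma consistent_Un: "consistent X \<Longrightarrow> consistent Y \<Longrightarrow> consistent (X \<union> Y)"
  and consistent_Int: "consistent X \<Longrightarrow> consistent Y \<Longrightarrow> consistent (X \<inter> Y)"
  unfolding consistent_def by blast+

text \<open>If \<open>e\<close> entered \<open>C'\<close>, uncrossing with a mincut \<open>C\<close>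
  for \<open>e\<close> would put \<open>e\<close> into the error term. Its capacity exceeds
  \<open>weight e - flow_value\<close>, which makes union and intersection too cheap.\<close>

lemma mincut_for_consistent:
  assumes e': "vital G c s t e'" and C': "mincut_for G c s t e' C'"
  shows "consistent C'"
  unfolding consistent_def
proof (intro allI impI, rule ccontr)
  fix e assume e: "vital G c s t e" and rev: "head G e \<in> C'" "tail G e \<notin> C'"
  obtain C where C: "st_cut G s t C" "e \<in> contributing G C" "cap C = weight e"
    using weight_attained[OF e] .
  have C'': "st_cut G s t C'" "e' \<in> contributing G C'" "cap C' = weight e'"
    using mincut_for_iff_weight[OF e'] C' by auto
  let ?R = "{e \<in> arcs G. tail G e \<in> C - C' \<and> head G e \<in> C' - C \<or>
                         tail G e \<in> C' - C \<and> head G e \<in> C - C'}"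
  have uncross: "cap C + cap C' = cap (C \<union> C') + cap (C \<inter> C') + (\<Sum>e\<in>?R. c e)"
    by (rule cut_capacity_uncross) simp
  have eR: "e \<in> ?R"
    using rev C(2) by (auto simp: contributing_def)
  have ge: "flow_value \<le> cap (C \<union> C')" "flow_value \<le> cap (C \<inter> C')"
    using C(1) C''(1) st_cut_Un st_cut_Int flow_value_le by metis+
  have sub: "sum c S \<le> (\<Sum>e\<in>?R. c e)" if "S \<subseteq> ?R" for S
    using that pos by (intro sum_mono2) (auto intro: less_imp_le)
  have less: "weight e < flow_value + c e" "weight e' < flow_value + c e'"
    using e e' weight_less by blast+
  have "c e \<le> (\<Sum>e\<in>?R. c e)"
    using sub[of "{e}"] eR by simp
  then have "\<not> weight e' \<le> cap (C \<union> C')" "\<not> weight e' \<le> cap (C \<inter> C')"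
    using uncross ge less C(3) C''(3) by linarith+
  \<comment> \<open>An edge leaving \<open>C'\<close> that contributes to neither the union nor the
    intersection runs from \<open>C' - C\<close> to \<open>C - C'\<close>. So \<open>e'\<close>
    enters the error term as well, and union and intersection together fall below twice
    \<open>flow_value\<close>.\<close>
  then have "e' \<notin> contributing G (C \<union> C')" "e' \<notin> contributing G (C \<inter> C')"
    using weight_le C(1) C''(1) st_cut_Un st_cut_Int by metis+
  then have e'R: "e' \<in> ?R" "e \<noteq> e'"
    using C''(2) rev by (auto simp: contributing_def)
  then have "c e + c e' \<le> (\<Sum>e\<in>?R. c e)"
    using sub[of "{e, e'}"] eR by simp
  then show False
    using uncross ge less C(3) C''(3) by linarith
qed

section \<open>The lattice of minimum consistent separating cuts\<close>

definition separating :: "'a \<Rightarrow> 'a \<Rightarrow> 'a set \<Rightarrow> bool" where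
  "separating a b C \<longleftrightarrow> st_cut G s t C \<and> consistent C \<and> a \<in> C \<and> b \<notin> C"

definition min_family :: "'a \<Rightarrow> 'a \<Rightarrow> 'a set set" where
  "min_family a b = {C. separating a b C \<and> (\<forall>C'. separating a b C' \<longrightarrow> cap C \<le> cap C')}"

text \<open>Endpoints of edges are paired in both directions, as implications may run against an
  edge. Pairs from \<open>s\<close> express that a vertex is in every member, pairs into
  \<open>t\<close> that it is in none, and pairs from \<open>t\<close> supply the arcs that precede
  an arc leaving a cut.\<close>

definition local_pairs :: "('a \<times> 'a) set" where
  "local_pairs = {(u, v) \<in> verts G \<times> verts G.
     (\<exists>e\<in>arcs G. {u, v} = {tail G e, head G e}) \<or> u = s \<or> u = t \<or> v = t}"

lemma separating_Un: "separating a b X \<Longrightarrow> separating a b Y \<Longrightarrow> separating a b (X \<union> Y)"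
  and separating_Int: "separating a b X \<Longrightarrow> separating a b Y \<Longrightarrow> separating a b (X \<inter> Y)"
  by (auto simp: separating_def intro: st_cut_Un st_cut_Int consistent_Un consistent_Int)

text \<open>Union and intersection are again separating, so each costs at least the minimum, while
  submodularity bounds their sum by twice the minimum.\<close>

lemma min_family_Un_Int:
  assumes "X \<in> min_family a b" "Y \<in> min_family a b"
  shows "X \<union> Y \<in> min_family a b" "X \<inter> Y \<in> min_family a b"
proof -
  have sep: "separating a b (X \<union> Y)" "separating a b (X \<inter> Y)"
    using assms separating_Un separating_Int by (auto simp: min_family_def)
  then have "cap X \<le> cap (X \<union> Y)" "cap X \<le> cap (X \<inter> Y)"
    "cap Y \<le> cap (X \<union> Y)" "cap Y \<le> cap (X \<inter> Y)"
    using assms by (auto simp: min_family_def)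
  then have le: "cap (X \<union> Y) \<le> cap X" "cap (X \<inter> Y) \<le> cap X"
    using submodular[of X Y] by linarith+
  show "X \<union> Y \<in> min_family a b" "X \<inter> Y \<in> min_family a b"
    using sep le assms(1) unfolding min_family_def by (auto intro: order_trans)
qed

lemma finite_min_family: "finite (min_family a b)"
  using finite_st_cuts by (rule rev_finite_subset) (auto simp: min_family_def separating_def)

lemma min_family_capD: "X \<in> min_family a b \<Longrightarrow> separating a b Y \<Longrightarrow> cap X \<le> cap Y"
  by (auto simp: min_family_def)

lemma min_family_sep: "X \<in> min_family a b \<Longrightarrow> separating a b X"
  by (auto simp: min_family_def)

lemma arc_local_pairs:
  assumes "e \<in> arcs G"
  shows "(tail G e, head G e) \<in> local_pairs" "(head G e, tail G e) \<in> local_pairs"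
  using assms unfolding local_pairs_def by auto

text \<open>The implications between endpoints of an edge determine the lattice: let \<open>T\<close> be its least
  member that contains \<open>Z\<close>, and \<open>C\<close> a maximal member that does not cover \<open>T - Z\<close>. No edge joins
  \<open>Z - C\<close> and \<open>T - Z - C\<close>, so uncrossing \<open>(Z \<union> C) \<inter> T\<close> and \<open>T \<inter> C \<union> (T - Z)\<close> loses nothing, and
  one of the two would be cheaper than the minimum unless \<open>T = Z\<close>.\<close>

lemma mem_min_family_if_closed:
  fixes a b
  defines "F \<equiv> min_family a b"
  assumes ne: "F \<noteq> {}" and a: "a \<in> verts G" and b: "b \<in> verts G"
    and Z: "st_cut G s t Z"
    and closed: "\<And>u v. (u, v) \<in> local_pairs \<Longrightarrow> u \<in> Z \<Longrightarrow> \<forall>C\<in>F. u \<in> C \<longrightarrow> v \<in> C \<Longrightarrow> v \<in> Z"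
  shows "Z \<in> F"
proof -
  have F: "C \<subseteq> verts G" "s \<in> C" "t \<notin> C" "consistent C" "a \<in> C" "b \<notin> C" if "C \<in> F" for C
    using that by (auto simp: F_def min_family_def separating_def st_cut_def)
  have Z': "Z \<subseteq> verts G" "s \<in> Z" "t \<notin> Z"
    using Z by (auto simp: st_cut_def)
  have adj: "\<exists>C\<in>F. u \<in> C \<and> v \<notin> C" if "(u, v) \<in> local_pairs" "u \<in> Z" "v \<notin> Z"
    for u v
    using closed that by blast
  have sout: "\<exists>C\<in>F. v \<notin> C" if "v \<in> verts G" "v \<notin> Z" for v
    using closed[of s v] that Z' s_in by (auto simp: local_pairs_def)
  have tout: "\<exists>C\<in>F. u \<in> C" if "u \<in> Z" for u
    using closed[of u t] that Z' t_in by (auto simp: local_pairs_def)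
  have finF: "finite F"
    unfolding F_def by (rule finite_min_family)
  \<comment> \<open>All members are consistent, so the head of a vital edge implies its tail. The
    reversed pair is local, and \<open>Z\<close> respects this implication.\<close>
  have "consistent Z"
    unfolding consistent_def
  proof (intro allI impI, rule ccontr)
    fix e assume e: "vital G c s t e" "head G e \<in> Z" "tail G e \<notin> Z"
    then obtain C where "C \<in> F" "head G e \<in> C" "tail G e \<notin> C"
      using adj[OF arc_local_pairs(2)] vital_arc by blast
    then show False
      using F(4) e(1) by (auto simp: consistent_def)
  qed
  moreover have "a \<in> Z"
    using sout a F(5) by blast
  moreover have "b \<notin> Z"
    using tout F(6) by blast
  ultimately have sepZ: "separating a b Z"
    using Z by (simp add: separating_def)
  have "\<Union>F \<in> F"
    using finF ne
  proof (rule finite_Sup_in)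
    show "x \<union> y \<in> F" if "x \<in> F" "y \<in> F" for x y
      using that min_family_Un_Int by (simp add: F_def)
  qed
  define T where "T = \<Inter>{C \<in> F. Z \<subseteq> C}"
  have "T \<in> {C \<in> F. Z \<subseteq> C}"
    unfolding T_def
  proof (rule finite_Inf_in)
    show "{C \<in> F. Z \<subseteq> C} \<noteq> {}"
      \<comment> \<open>Every vertex of \<open>Z\<close> lies in some member, so the largest member
        covers \<open>Z\<close>.\<close>
      using \<open>\<Union>F \<in> F\<close> tout by blast
    show "x \<inter> y \<in> {C \<in> F. Z \<subseteq> C}" if "x \<in> {C \<in> F. Z \<subseteq> C}" "y \<in> {C \<in> F. Z \<subseteq> C}" for x y
      using that min_family_Un_Int by (simp add: F_def)
  qed (use finF in simp)
  then have T: "T \<in> F" "Z \<subseteq> T"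
    by auto
  show "Z \<in> F"
  proof (rule ccontr)
    assume "Z \<notin> F"
    define \<C> where "\<C> = {C \<in> F. \<not> T - Z \<subseteq> C}"
    have "T \<noteq> Z"
      using T \<open>Z \<notin> F\<close> by auto
    then obtain v where v: "v \<in> T" "v \<notin> Z"
      using T(2) by blast
    then obtain C0 where "C0 \<in> F" "v \<notin> C0"
      using sout F(1)[OF T(1)] by blast
    then have "\<C> \<noteq> {}"
      using v by (auto simp: \<C>_def)
    moreover have "finite \<C>"
      using finF by (simp add: \<C>_def)
    ultimately obtain C where C: "C \<in> \<C>" "\<And>C'. C' \<in> \<C> \<Longrightarrow> C \<subseteq> C' \<Longrightarrow> C' = C"
      using finite_has_maximal[of \<C>] by blast
    have CF: "C \<in> F" "\<not> T - Z \<subseteq> C"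
      using C(1) by (auto simp: \<C>_def)
    \<comment> \<open>\<open>Z\<close> is closed, so some member \<open>C'\<close> contains
      \<open>u\<close> but not \<open>v\<close>. Then \<open>C \<union> C'\<close> still misses
      \<open>v\<close> and is strictly larger than \<open>C\<close>, against maximality.\<close>
    have noarc: False
      if uv: "(u, v) \<in> local_pairs" "u \<in> Z - C" "v \<in> T - Z - C" for u v
    proof -
      obtain C' where C': "C' \<in> F" "u \<in> C'" "v \<notin> C'"
        using adj[OF uv(1)] uv by auto
      have "C \<union> C' \<in> \<C>"
        using min_family_Un_Int(1)[of C a b C'] CF C' uv(3)
        unfolding \<C>_def F_def by blast
      then show False
        using C(2)[of "C \<union> C'"] C'(2) uv(2) by auto
    qed
    define X where "X = (Z \<union> C) \<inter> T"
    define Y where "Y = (T \<inter> C) \<union> (T - Z)"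
    have sepTC: "separating a b T" "separating a b C"
      using T(1) CF(1) min_family_sep by (auto simp: F_def)
    have TC: "T \<inter> C \<in> F"
      using min_family_Un_Int(2) T(1) CF(1) by (simp add: F_def)
    have sepX: "separating a b X"
      unfolding X_def using sepZ sepTC by (intro separating_Int separating_Un)
    have "X \<notin> F"
    \<comment> \<open>As \<open>Z \<subseteq> X\<close>, minimality of \<open>T\<close> would give
      \<open>T \<subseteq> X\<close>, and then \<open>C\<close> would cover
      \<open>T - Z\<close>.\<close>
    proof
      assume "X \<in> F"
      then have "T \<subseteq> X"
        unfolding T_def using T(2) by (auto simp: X_def)
      then show False
        using CF(2) by (auto simp: X_def)
    qed
    have "\<not> cap X \<le> cap T"
    proof
      assume "cap X \<le> cap T"
      then have "X \<in> min_family a b"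
        using sepX T(1) unfolding F_def min_family_def by (auto intro: order_trans)
      then show False
        using \<open>X \<notin> F\<close> by (simp add: F_def)
    qed
    \<comment> \<open>\<open>T - Z\<close> need not be consistent, so the lattice operations do not
      suffice. A vital edge entering \<open>Y\<close> from \<open>Z - C\<close> would have its head
      in \<open>T - Z - C\<close>, as \<open>C\<close> is consistent; \<open>noarc\<close> excludes
      this.\<close>
    have "consistent Y"
      unfolding consistent_def
    proof (intro allI impI)
      fix e assume e: "vital G c s t e" "head G e \<in> Y"
      have cons: "consistent T" "consistent C"
        using F(4) T(1) CF(1) by auto
      have "tail G e \<in> T"
        using e cons(1) by (auto simp: Y_def consistent_def)
      moreover have "tail G e \<in> C" if "tail G e \<in> Z"
      proof (rule ccontr)
        assume "tail G e \<notin> C"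
        then have "head G e \<notin> C"
          using e(1) cons(2) by (auto simp: consistent_def)
        then show False
          using noarc[OF arc_local_pairs(1)[OF vital_arc[OF e(1)]]] e(2) that \<open>tail G e \<notin> C\<close>
          by (simp add: Y_def)
      qed
      ultimately show "tail G e \<in> Y"
        by (auto simp: Y_def)
    qed
    then have "separating a b Y"
      using F[OF T(1)] F[OF CF(1)] by (auto simp: separating_def st_cut_def Y_def)
    then have "cap T \<le> cap Y"
      using min_family_capD T(1) by (simp add: F_def)
    have "cap (T \<inter> C) \<le> cap T"
      using min_family_capD TC sepTC(1) by (simp add: F_def)
    have none: "{e \<in> arcs G. tail G e \<in> X - Y \<and> head G e \<in> Y - X \<or>
                         tail G e \<in> Y - X \<and> head G e \<in> X - Y} = {}" (is "?R = {}")
    proof -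
      have "X - Y \<subseteq> Z - C" "Y - X \<subseteq> T - Z - C"
        using T(2) by (auto simp: X_def Y_def)
      then show ?thesis
        using noarc[OF arc_local_pairs(1)] noarc[OF arc_local_pairs(2)] by blast
    qed
    have "cap X + cap Y = cap (X \<union> Y) + cap (X \<inter> Y)"
      using cut_capacity_uncross[of G c X Y] unfolding none by simp
    moreover have "X \<union> Y = T" "X \<inter> Y = T \<inter> C"
      using T(2) by (auto simp: X_def Y_def)
    ultimately show False
      using \<open>\<not> cap X \<le> cap T\<close> \<open>cap T \<le> cap Y\<close> \<open>cap (T \<inter> C) \<le> cap T\<close> by simp
  qed
qed

lemma card_local_pairs: "card local_pairs \<le> 2 * card (arcs G) + 3 * card (verts G)"
proof -
  let ?V = "verts G"
  let ?S = "(\<lambda>e. (tail G e, head G e)) ` arcs G \<union> (\<lambda>e. (head G e, tail G e)) ` arcs G \<union>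
    (Pair s ` ?V \<union> Pair t ` ?V \<union> (\<lambda>v. (v, t)) ` ?V)"
  have "local_pairs \<subseteq> ?S"
    by (auto simp: local_pairs_def doubleton_eq_iff)
  then have "card local_pairs \<le> card ?S"
    by (intro card_mono) auto
  also have "\<dots> \<le> (card (arcs G) + card (arcs G)) + (card ?V + card ?V + card ?V)"
    by (intro order_trans[OF card_Un_le] add_mono card_image_le) auto
  finally show ?thesis
    by simp
qed

end

subsection \<open>Roots of the components of threshold graphs\<close>

definition conn :: "('b \<Rightarrow> 'a) \<Rightarrow> ('b \<Rightarrow> 'a) \<Rightarrow> 'b set \<Rightarrow> ('a \<times> 'a) set" where
  "conn src tgt E = ((\<lambda>e. (src e, tgt e)) ` E \<union> (\<lambda>e. (tgt e, src e)) ` E)\<^sup>*"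

lemma conn_refl [simp]: "(a, a) \<in> conn src tgt E"
  by (simp add: conn_def)

lemma conn_trans: "(a, b) \<in> conn src tgt E \<Longrightarrow> (b, d) \<in> conn src tgt E \<Longrightarrow> (a, d) \<in> conn src tgt E"
  by (simp add: conn_def)

lemma conn_sym: "(a, b) \<in> conn src tgt E \<Longrightarrow> (b, a) \<in> conn src tgt E"
  unfolding conn_def by (rule symD[OF sym_rtrancl]) (auto intro!: symI)

lemma conn_mono: "E \<subseteq> E' \<Longrightarrow> (a, b) \<in> conn src tgt E \<Longrightarrow> (a, b) \<in> conn src tgt E'"
  unfolding conn_def by (erule rtrancl_mono[THEN subsetD, rotated]) blast

lemma conn_edge: "e \<in> E \<Longrightarrow> (src e, tgt e) \<in> conn src tgt E"
  unfolding conn_def by blast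

lemma conn_closed:
  assumes "(a, b) \<in> conn src tgt E" "a \<in> S" "\<And>e. e \<in> E \<Longrightarrow> src e \<in> S \<longleftrightarrow> tgt e \<in> S"
  shows "b \<in> S"
  using assms(1) unfolding conn_def
  by (induction rule: rtrancl_induct) (use assms(2,3) in auto)

text \<open>The root of a component is its least vertex. When the threshold drops, components merge and
  each merged component but one loses its root; every vertex thus stops being a root at most
  once, and \<open>\<rho>\<close> maps it to the root of the component that absorbs it at that moment.\<close>

lemma component_roots:
  fixes w :: "'b \<Rightarrow> real" and src tgt :: "'b \<Rightarrow> 'a"
  assumes fin: "finite E"
  defines "P \<equiv> src ` E \<union> tgt ` E"
  shows "\<exists>\<rho>. \<forall>e\<in>E. \<exists>u\<in>P. \<exists>v\<in>P. \<exists>r\<in>P.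
    (src e, u) \<in> conn src tgt {e' \<in> E. w e < w e'} \<and>
    (tgt e, v) \<in> conn src tgt {e' \<in> E. w e < w e'} \<and>
    (u, r) \<in> conn src tgt {e' \<in> E. w e \<le> w e'} \<and>
    (v, r) \<in> conn src tgt {e' \<in> E. w e \<le> w e'} \<and>
    (u \<noteq> r \<longrightarrow> \<rho> u = r) \<and> (v \<noteq> r \<longrightarrow> \<rho> v = r)"
proof -
  have "finite P"
    using fin by (simp add: P_def)
  \<comment> \<open>An arbitrary numbering of \<open>P\<close> gives "least vertex" a meaning, since
    \<open>'a\<close> carries no order.\<close>
  then obtain f :: "'a \<Rightarrow> nat" where f: "inj_on f P"
    using finite_imp_inj_to_nat_seg[of P] by auto
  define root where "root R v = (ARG_MIN f u. (v, u) \<in> R)" for R :: "('a \<times> 'a) set" and v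
  define ge where "ge l = conn src tgt {e' \<in> E. l \<le> w e'}" for l
  define gt where "gt l = conn src tgt {e' \<in> E. l < w e'}" for l
  have root_conn: "(v, root (conn src tgt E') v) \<in> conn src tgt E'" for E' v
    unfolding root_def by (rule arg_min_natI[of _ v]) simp
  have root_le: "f (root R v) \<le> f u" if "(v, u) \<in> R" for R u v
    unfolding root_def using that by (rule arg_min_nat_le)
  have root_eq: "root (conn src tgt E') u = root (conn src tgt E') v"
    if "(u, v) \<in> conn src tgt E'" for E' u v
  proof -
    have "(u, x) \<in> conn src tgt E' \<longleftrightarrow> (v, x) \<in> conn src tgt E'" for x
      using conn_trans[OF that] conn_trans[OF conn_sym[OF that]] by blast
    then show ?thesis
      by (simp add: root_def)
  qed
  have in_P: "b \<in> P" if "(a, b) \<in> conn src tgt E'" "a \<in> P" "E' \<subseteq> E" for a b E'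
    using that(1,2) by (rule conn_closed) (use that(3) in \<open>auto simp: P_def\<close>)
  \<comment> \<open>The highest threshold at which \<open>u\<close> is no longer a root; a junk
    value if \<open>u\<close> always remains one.\<close>
  define \<mu> where "\<mu> u = Max (w ` {e \<in> E. root (ge (w e)) u \<noteq> u})" for u
  define \<rho> where "\<rho> u = root (ge (\<mu> u)) u" for u
  have \<rho>: "\<rho> (root (gt (w e)) x) = root (ge (w e)) x"
    if e: "e \<in> E" and x: "x \<in> P" and neq: "root (gt (w e)) x \<noteq> root (ge (w e)) x" for e x
  proof -
    let ?u = "root (gt (w e)) x"
    have xu: "(x, ?u) \<in> gt (w e)"
      unfolding gt_def by (rule root_conn)
    then have "?u \<in> P"
      using in_P[of x ?u] x by (auto simp: gt_def)
    have "(x, ?u) \<in> ge (w e)"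
      using xu unfolding gt_def ge_def by (rule conn_mono[rotated]) auto
    then have eq: "root (ge (w e)) ?u = root (ge (w e)) x"
      unfolding ge_def by (rule root_eq[symmetric])
    \<comment> \<open>Above the threshold \<open>w e\<close>, the component of \<open>?u\<close>
      lies inside its component under \<open>gt (w e)\<close>, where \<open>?u\<close> is already
      least.\<close>
    have stays: "root (ge (w e')) ?u = ?u" if "w e < w e'" for e'
    proof -
      let ?v = "root (ge (w e')) ?u"
      have uv: "(?u, ?v) \<in> ge (w e')"
        unfolding ge_def by (rule root_conn)
      have "(?u, ?v) \<in> gt (w e)"
        unfolding gt_def ge_def
        by (rule conn_mono[OF _ uv[unfolded gt_def ge_def]]) (use that in auto)
      then have "(x, ?v) \<in> gt (w e)"
        using xu unfolding gt_def by (rule conn_trans[rotated])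
      then have "f ?u \<le> f ?v"
        by (rule root_le)
      moreover have "f ?v \<le> f ?u"
        by (rule root_le) (simp add: ge_def)
      moreover have "?v \<in> P"
        using uv \<open>?u \<in> P\<close> unfolding ge_def by (rule in_P) auto
      ultimately show ?thesis
        using f \<open>?u \<in> P\<close> by (auto dest: inj_onD)
    qed
    have "\<mu> ?u = w e"
      unfolding \<mu>_def
    proof (rule Max_eqI)
      show "w e \<in> w ` {e \<in> E. root (ge (w e)) ?u \<noteq> ?u}"
        using e eq neq by (intro imageI) simp
      show "y \<le> w e" if "y \<in> w ` {e \<in> E. root (ge (w e)) ?u \<noteq> ?u}" for y
        using that stays not_less by blast
    qed (use fin in simp)
    then show ?thesis
      by (simp add: \<rho>_def eq)
  qed
  show ?thesis
  proof (intro exI ballI)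
    fix e assume e: "e \<in> E"
    let ?u = "root (gt (w e)) (src e)" and ?v = "root (gt (w e)) (tgt e)"
    let ?r = "root (ge (w e)) (src e)"
    have ends: "src e \<in> P" "tgt e \<in> P"
      using e by (auto simp: P_def)
    have u: "(src e, ?u) \<in> gt (w e)" and v: "(tgt e, ?v) \<in> gt (w e)"
      unfolding gt_def by (rule root_conn)+
    have r: "(src e, ?r) \<in> ge (w e)"
      unfolding ge_def by (rule root_conn)
    \<comment> \<open>The edge \<open>e\<close> itself meets the threshold, so both endpoints share
      the root \<open>?r\<close>.\<close>
    have ht: "(src e, tgt e) \<in> ge (w e)"
      unfolding ge_def using e by (intro conn_edge) simp
    then have rv: "root (ge (w e)) (tgt e) = ?r"
      unfolding ge_def by (rule root_eq[symmetric])
    have up: "(a, b) \<in> ge (w e)" if "(a, b) \<in> gt (w e)" for a b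
      using that unfolding gt_def ge_def by (rule conn_mono[rotated]) auto
    have ge_trans: "(a, d) \<in> ge (w e)" if "(b, a) \<in> ge (w e)" "(b, d) \<in> ge (w e)" for a b d
      using that unfolding ge_def by (rule conn_trans[OF conn_sym])
    have "(?u, ?r) \<in> ge (w e)" "(?v, ?r) \<in> ge (w e)"
      using ge_trans[OF up[OF u] r] ge_trans[OF up[OF v] ge_trans[OF ht r]] by simp_all
    moreover have "?u \<in> P" "?v \<in> P" "?r \<in> P"
      using in_P[OF u[unfolded gt_def] ends(1)] in_P[OF v[unfolded gt_def] ends(2)]
        in_P[OF r[unfolded ge_def] ends(1)] by (auto simp: gt_def ge_def)
    moreover have "?u \<noteq> ?r \<longrightarrow> \<rho> ?u = ?r" "?v \<noteq> ?r \<longrightarrow> \<rho> ?v = ?r"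
      using \<rho>[OF e ends(1)] \<rho>[OF e ends(2)] rv by auto
    ultimately show "\<exists>u\<in>P. \<exists>v\<in>P. \<exists>r\<in>P.
        (src e, u) \<in> conn src tgt {e' \<in> E. w e < w e'} \<and>
        (tgt e, v) \<in> conn src tgt {e' \<in> E. w e < w e'} \<and>
        (u, r) \<in> conn src tgt {e' \<in> E. w e \<le> w e'} \<and>
        (v, r) \<in> conn src tgt {e' \<in> E. w e \<le> w e'} \<and>
        (u \<noteq> r \<longrightarrow> \<rho> u = r) \<and> (v \<noteq> r \<longrightarrow> \<rho> v = r)"
      using u v unfolding gt_def ge_def by (intro bexI conjI)
  qed
qed

subsection \<open>The structure\<close>

context st_network
begin

abbreviation vital_conn :: "('b \<Rightarrow> bool) \<Rightarrow> ('a \<times> 'a) set" where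
  "vital_conn Q \<equiv> conn (tail G) (head G) {e \<in> {e. vital G c s t e}. Q e}"

text \<open>A vital edge cannot enter \<open>C\<close> by consistency, and one satisfying
  \<open>Q\<close> cannot leave it either, since \<open>C\<close> would then cost at least its
  weight.\<close>

lemma not_separated:
  assumes "(a, b) \<in> vital_conn Q" "st_cut G s t C" "consistent C" "\<And>e. Q e \<Longrightarrow> cap C < weight e"
  shows "a \<in> C \<longleftrightarrow> b \<in> C"
proof -
  have iff: "tail G e \<in> C \<longleftrightarrow> head G e \<in> C" if e: "vital G c s t e" "Q e" for e
  proof
    assume "tail G e \<in> C"
    show "head G e \<in> C"
    proof (rule ccontr)
      assume "head G e \<notin> C"
      then have "weight e \<le> cap C"
        using e \<open>tail G e \<in> C\<close> assms(2) vital_arc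
        by (intro weight_le) (auto simp: contributing_def)
      then show False
        using assms(4)[OF e(2)] by simp
    qed
  qed (use assms(3) e(1) in \<open>simp add: consistent_def\<close>)
  show ?thesis
    using conn_closed[OF assms(1), of C] conn_closed[OF conn_sym[OF assms(1)], of C] iff by auto
qed

abbreviation min_dag :: "'a \<Rightarrow> 'a \<Rightarrow> 'a set pair_pre_digraph" where
  "min_dag a b \<equiv> family_dag (verts G) local_pairs (min_family a b)"

lemma local_pairs_subset: "local_pairs \<subseteq> verts G \<times> verts G"
  by (auto simp: local_pairs_def)

text \<open>A consistent cut cheaper than \<open>weight e\<close> cannot separate \<open>a\<close>
  from \<open>b\<close>, so the minimum of the family is \<open>weight e\<close>, attained by every
  mincut for \<open>e\<close> on the right side.\<close>

lemma min_family_if_mincut_for: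
  assumes e: "vital G c s t e" and ab: "(a, b) \<in> vital_conn (\<lambda>e'. weight e \<le> weight e')"
    and C: "mincut_for G c s t e C" "a \<in> C" "b \<notin> C"
  shows "C \<in> min_family a b"
proof -
  have C': "st_cut G s t C" "cap C = weight e"
    using C(1) mincut_for_iff_weight[OF e] by auto
  have "weight e \<le> cap C'" if C': "separating a b C'" for C'
  proof (rule ccontr)
    assume "\<not> weight e \<le> cap C'"
    then have "a \<in> C' \<longleftrightarrow> b \<in> C'"
      using C' by (intro not_separated[OF ab]) (auto simp: separating_def)
    then show False
      using C' by (simp add: separating_def)
  qed
  then show ?thesis
    using C C' mincut_for_consistent[OF e C(1)] by (auto simp: min_family_def separating_def)
qed

lemma one_transversal_cut_min_dag:
  assumes "C \<in> min_family a b"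
  shows "one_transversal_cut (min_dag a b) s t C"
  using assms local_pairs_subset
  by (intro one_transversal_cut_family_dag) (auto simp: min_family_def separating_def st_cut_def)

text \<open>A 1-transversal cut respects all implications between local pairs, and these determine
  membership in the family.\<close>

lemma min_family_if_one_transversal_cut:
  assumes ne: "min_family a b \<noteq> {}" and ab: "a \<in> verts G" "b \<in> verts G"
    and C: "st_cut G s t C" "one_transversal_cut (min_dag a b) s t C"
  shows "C \<in> min_family a b"
proof (rule mem_min_family_if_closed[OF ne ab C(1)])
  fix u v assume uv: "(u, v) \<in> local_pairs" "u \<in> C" "\<forall>C\<in>min_family a b. u \<in> C \<longrightarrow> v \<in> C"
  show "v \<in> C"
  proof (rule closed_if_one_transversal_cut[OF C(2) local_pairs_subset t_in _ _ uv(1,2)])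
    show "{t} \<times> verts G \<subseteq> local_pairs"
      using t_in by (auto simp: local_pairs_def)
    show "\<forall>C\<in>min_family a b. t \<notin> C"
      by (auto simp: min_family_def separating_def st_cut_def)
    show "sig (min_family a b) u \<subseteq> sig (min_family a b) v"
      using uv(3) by (auto simp: sig_def)
  qed
qed

text \<open>The mincut \<open>C0\<close> fixes the capacity of all members of the family at
  \<open>weight e\<close>. Still, \<open>e\<close> need not contribute to each of them, so this is a
  separate assumption.\<close>

lemma mincut_for_if_one_transversal_cut:
  assumes e: "vital G c s t e" and ab: "(a, b) \<in> vital_conn (\<lambda>e'. weight e \<le> weight e')"
    "a \<in> verts G" "b \<in> verts G"
    and C0: "mincut_for G c s t e C0" "a \<in> C0" "b \<notin> C0"
    and C: "st_cut G s t C" "one_transversal_cut (min_dag a b) s t C" "e \<in> contributing G C"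
  shows "mincut_for G c s t e C"
proof -
  have C0F: "C0 \<in> min_family a b"
    using min_family_if_mincut_for e ab(1) C0 .
  then have "C \<in> min_family a b"
    using min_family_if_one_transversal_cut ab(2,3) C(1,2) by blast
  then have "cap C \<le> cap C0"
    using C0F min_family_capD min_family_sep by blast
  then show ?thesis
    using C0(1) C(1,3) weight_le[OF C(1,3)] mincut_for_iff_weight[OF e] by auto
qed

lemma partition_dag_min_dag:
  assumes "min_family a b \<noteq> {}"
  shows "partition_dag G s t (min_dag a b)"
proof -
  obtain C where "C \<in> min_family a b"
    using assms by blast
  moreover from this have "s \<in> C" "t \<notin> C"
    by (auto simp: min_family_def separating_def st_cut_def)
  ultimately show ?thesis
    using local_pairs_subset by (intro partition_dag_family_dag) auto
qed

lemma dag_size_min_dag: "dag_size (min_dag a b) \<le> 5 * card (verts G) + 2 * card (arcs G)"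
proof -
  have "finite local_pairs"
    using local_pairs_subset by (rule finite_subset) simp
  then have "dag_size (min_dag a b) \<le> 2 * card (verts G) + card local_pairs"
    by (intro dag_size_family_dag) auto
  then show ?thesis
    using card_local_pairs by simp
qed

section \<open>Assembling the DAGs\<close>

definition represents_mincuts where
  "represents_mincuts e Ds Dt \<longleftrightarrow>
    (\<forall>C. mincut_for G c s t e C \<longrightarrow> stores Ds C \<or> stores Dt C) \<and>
    (\<forall>C. st_cut G s t C \<longrightarrow>
      (mincut_for G c s t e C \<longleftrightarrow>
        (one_transversal_cut Ds s t C \<or> one_transversal_cut Dt s t C) \<and> e \<in> contributing G C))"

lemma represents_mincutsI:
  assumes "\<And>C. mincut_for G c s t e C \<Longrightarrow>
      one_transversal_cut Ds s t C \<or> one_transversal_cut Dt s t C"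
    and "\<And>C. st_cut G s t C \<Longrightarrow> e \<in> contributing G C \<Longrightarrow>
      one_transversal_cut Ds s t C \<or> one_transversal_cut Dt s t C \<Longrightarrow> mincut_for G c s t e C"
  shows "represents_mincuts e Ds Dt"
proof -
  have "e \<in> contributing G C" if "mincut_for G c s t e C" for C
    using that by (simp add: mincut_for_def)
  then show ?thesis
    unfolding represents_mincuts_def
    using assms stores_if_one_transversal_cut[of Ds s t] stores_if_one_transversal_cut[of Dt s t]
    by (intro conjI allI impI) metis+
qed

lemma exists_structure:
  "\<exists>S. finite S \<and> card S \<le> 24 * card (verts G) \<and>
    (\<Sum>D\<in>S. dag_size D) \<le> 24 * (card (arcs G) * card (verts G)) \<and>
    (\<forall>D\<in>S. partition_dag G s t D) \<and>
    (\<forall>e. vital G c s t e \<longrightarrow> (\<exists>Ds\<in>S. \<exists>Dt\<in>S. represents_mincuts e Ds Dt))"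
proof -
  define E where "E = {e. vital G c s t e}"
  define P where "P = tail G ` E \<union> head G ` E"
  have EA: "E \<subseteq> arcs G"
    using vital_arc by (auto simp: E_def)
  then have "finite E"
    by (rule finite_subset) simp
  then have "finite P"
    by (simp add: P_def)
  have PV: "P \<subseteq> verts G"
    using EA by (auto simp: P_def)
  have "\<exists>\<rho>. \<forall>e\<in>E. \<exists>u\<in>P. \<exists>v\<in>P. \<exists>r\<in>P.
    (tail G e, u) \<in> vital_conn (\<lambda>e'. weight e < weight e') \<and>
    (head G e, v) \<in> vital_conn (\<lambda>e'. weight e < weight e') \<and>
    (u, r) \<in> vital_conn (\<lambda>e'. weight e \<le> weight e') \<and>
    (v, r) \<in> vital_conn (\<lambda>e'. weight e \<le> weight e') \<and>
    (u \<noteq> r \<longrightarrow> \<rho> u = r) \<and> (v \<noteq> r \<longrightarrow> \<rho> v = r)" (is "\<exists>\<rho>. ?roots \<rho>")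
    using component_roots[OF \<open>finite E\<close>, of "tail G" "head G" weight]
    unfolding P_def[symmetric] unfolding E_def .
  then obtain \<rho> where \<rho>: "?roots \<rho>" ..
  \<comment> \<open>One pair per vertex and orientation: \<open>(u, r)\<close> serves the tail side
    of an edge, \<open>(r, v)\<close> the head side. Empty families are dropped below, since a
    member is what separates \<open>s\<close> from \<open>t\<close> in the DAG.\<close>
  define Q where "Q = (\<lambda>u. (u, \<rho> u)) ` P \<union> (\<lambda>u. (\<rho> u, u)) ` P"
  define S where "S = case_prod min_dag ` {(a, b) \<in> Q. min_family a b \<noteq> {}}"
  have "finite Q"
    using \<open>finite P\<close> by (simp add: Q_def)
  then have fin: "finite {(a, b) \<in> Q. min_family a b \<noteq> {}}"
    by (rule rev_finite_subset) auto
  then have "finite S"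
    by (simp add: S_def)
  have "card S \<le> card {(a, b) \<in> Q. min_family a b \<noteq> {}}"
    unfolding S_def using fin by (rule card_image_le)
  also have "\<dots> \<le> card Q"
    using \<open>finite Q\<close> by (rule card_mono) auto
  also have "\<dots> \<le> card P + card P"
    unfolding Q_def using \<open>finite P\<close>
    by (intro order_trans[OF card_Un_le] add_mono card_image_le)
  finally have card_S: "card S \<le> 2 * card P"
    by simp
  have "card P \<le> card (verts G)"
    using PV by (intro card_mono) auto
  have "card P \<le> card E + card E"
    unfolding P_def using \<open>finite E\<close>
    by (intro order_trans[OF card_Un_le] add_mono card_image_le)
  also have "\<dots> \<le> 2 * card (arcs G)"
    using card_mono[OF _ EA] by simp
  finally have "card P \<le> 2 * card (arcs G)" .
  let ?n = "card (verts G)" and ?m = "card (arcs G)"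
  have small: "dag_size D \<le> 5 * ?n + 2 * ?m" if "D \<in> S" for D
  proof -
    obtain a b where "D = min_dag a b"
      using \<open>D \<in> S\<close> by (auto simp: S_def)
    then show ?thesis
      by (simp only: dag_size_min_dag)
  qed
  have "(\<Sum>D\<in>S. dag_size D) \<le> card S * (5 * ?n + 2 * ?m)"
    using sum_bounded_above[of S dag_size "5 * ?n + 2 * ?m", OF small] by simp
  also have "\<dots> = card S * (5 * ?n) + card S * (2 * ?m)"
    by (simp add: algebra_simps)
  \<comment> \<open>\<open>card S\<close> is bounded by \<open>4 * ?m\<close> in the first term and
    by \<open>2 * ?n\<close> in the second, so that both become multiples of \<open>?m * ?n\<close>;
    the constants add up to 24.\<close>
  also have "\<dots> \<le> (4 * ?m) * (5 * ?n) + (2 * ?n) * (2 * ?m)"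
    using card_S \<open>card P \<le> ?n\<close> \<open>card P \<le> 2 * ?m\<close> by (intro add_mono mult_mono) auto
  also have "\<dots> = 24 * (?m * ?n)"
    by simp
  finally have size: "(\<Sum>D\<in>S. dag_size D) \<le> 24 * (?m * ?n)" .
  have "\<exists>Ds\<in>S. \<exists>Dt\<in>S. represents_mincuts e Ds Dt" if e: "vital G c s t e" for e
  proof -
    have "e \<in> E"
      using e by (simp add: E_def)
    obtain u v r where in_P: "u \<in> P" "v \<in> P" "r \<in> P" and conn:
      "(tail G e, u) \<in> vital_conn (\<lambda>e'. weight e < weight e')"
      "(head G e, v) \<in> vital_conn (\<lambda>e'. weight e < weight e')"
      "(u, r) \<in> vital_conn (\<lambda>e'. weight e \<le> weight e')"
      "(v, r) \<in> vital_conn (\<lambda>e'. weight e \<le> weight e')"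
      and root: "u \<noteq> r \<longrightarrow> \<rho> u = r" "v \<noteq> r \<longrightarrow> \<rho> v = r"
      using bspec[OF \<rho> \<open>e \<in> E\<close>] by (elim bexE conjE) (rule that)
    have rv: "(r, v) \<in> vital_conn (\<lambda>e'. weight e \<le> weight e')"
      using conn(4) by (rule conn_sym)
    have in_V: "u \<in> verts G" "v \<in> verts G" "r \<in> verts G"
      using in_P PV by auto
    \<comment> \<open>A mincut for \<open>e\<close> is cheaper than all edges connecting
      \<open>tail G e\<close> to \<open>u\<close> and \<open>head G e\<close> to \<open>v\<close>,
      so it separates neither pair.\<close>
    have sides: "u \<in> C" "v \<notin> C" if C: "mincut_for G c s t e C" for C
    proof -
      have C': "st_cut G s t C" "e \<in> contributing G C" "cap C = weight e"
        using C mincut_for_iff_weight[OF e] by auto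
      have cons: "consistent C"
        using mincut_for_consistent e C .
      show "u \<in> C" "v \<notin> C"
        using not_separated[OF conn(1) C'(1) cons] not_separated[OF conn(2) C'(1) cons] C'(2,3)
        by (auto simp: contributing_def)
    qed
    have inside: "min_dag u r \<in> S" "one_transversal_cut (min_dag u r) s t C"
      if C: "mincut_for G c s t e C" "r \<notin> C" for C
    proof -
      have F: "C \<in> min_family u r"
        by (rule min_family_if_mincut_for[OF e conn(3) C(1) sides(1)[OF C(1)] C(2)])
      have "u \<noteq> r"
        using C sides[OF C(1)] by blast
      then have "(u, r) \<in> Q"
        using root(1) in_P(1) by (auto simp: Q_def)
      then show "min_dag u r \<in> S"
        using F by (force simp: S_def)
      show "one_transversal_cut (min_dag u r) s t C"
        using F by (rule one_transversal_cut_min_dag)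
    qed
    have outside: "min_dag r v \<in> S" "one_transversal_cut (min_dag r v) s t C"
      if C: "mincut_for G c s t e C" "r \<in> C" for C
    proof -
      have F: "C \<in> min_family r v"
        by (rule min_family_if_mincut_for[OF e rv C sides(2)[OF C(1)]])
      have "v \<noteq> r"
        using C sides[OF C(1)] by blast
      then have "(r, v) \<in> Q"
        using root(2) in_P(2) by (auto simp: Q_def)
      then show "min_dag r v \<in> S"
        using F by (force simp: S_def)
      show "one_transversal_cut (min_dag r v) s t C"
        using F by (rule one_transversal_cut_min_dag)
    qed
    have back_in: "mincut_for G c s t e C"
      if "mincut_for G c s t e C0" "r \<notin> C0" "st_cut G s t C" "e \<in> contributing G C"
        "one_transversal_cut (min_dag u r) s t C" for C C0
      by (rule mincut_for_if_one_transversal_cut[OF e conn(3) in_V(1,3)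
            that(1) sides(1)[OF that(1)] that(2,3,5,4)])
    have back_out: "mincut_for G c s t e C"
      if "mincut_for G c s t e C0" "r \<in> C0" "st_cut G s t C" "e \<in> contributing G C"
        "one_transversal_cut (min_dag r v) s t C" for C C0
      by (rule mincut_for_if_one_transversal_cut[OF e rv in_V(3,2)
            that(1,2) sides(2)[OF that(1)] that(3,5,4)])
    obtain C0 where C0: "mincut_for G c s t e C0"
      using weight_attained[OF e] mincut_for_iff_weight[OF e] by metis
    \<comment> \<open>If all mincuts for \<open>e\<close> agree on \<open>r\<close>, the family of
      the other side may be empty or consist of costlier cuts, so a single DAG then takes both
      roles.\<close>
    consider
        (both) "\<exists>C. mincut_for G c s t e C \<and> r \<notin> C" "\<exists>C. mincut_for G c s t e C \<and> r \<in> C"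
      | (inner) "\<forall>C. mincut_for G c s t e C \<longrightarrow> r \<notin> C"
      | (outer) "\<forall>C. mincut_for G c s t e C \<longrightarrow> r \<in> C"
      by blast
    then show ?thesis
    proof cases
      case both
      then obtain C1 C2 where C12: "mincut_for G c s t e C1" "r \<notin> C1"
        "mincut_for G c s t e C2" "r \<in> C2"
        by blast
      have "represents_mincuts e (min_dag u r) (min_dag r v)"
        using inside(2) outside(2) back_in[OF C12(1,2)] back_out[OF C12(3,4)]
        by (intro represents_mincutsI) metis+
      then show ?thesis
        using inside(1)[OF C12(1,2)] outside(1)[OF C12(3,4)] by blast
    next
      case inner
      then have "r \<notin> C0"
        using C0 by simp
      have "represents_mincuts e (min_dag u r) (min_dag u r)"
        using inner inside(2) back_in[OF C0 \<open>r \<notin> C0\<close>] by (intro represents_mincutsI) metis+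
      then show ?thesis
        using inside(1)[OF C0 \<open>r \<notin> C0\<close>] by blast
    next
      case outer
      then have "r \<in> C0"
        using C0 by simp
      have "represents_mincuts e (min_dag r v) (min_dag r v)"
        using outer outside(2) back_out[OF C0 \<open>r \<in> C0\<close>] by (intro represents_mincutsI) metis+
      then show ?thesis
        using outside(1)[OF C0 \<open>r \<in> C0\<close>] by blast
    qed
  qed
  moreover have "card S \<le> 24 * ?n"
    using card_S \<open>card P \<le> ?n\<close> by simp
  moreover have "\<forall>D\<in>S. partition_dag G s t D"
    using partition_dag_min_dag by (auto simp: S_def)
  ultimately show ?thesis
    using \<open>finite S\<close> size by blast
qed

end

theorem theorem7:
  shows "\<exists>K::nat. \<forall>(G :: ('a, 'b) pre_digraph) (c :: 'b \<Rightarrow> real) (s :: 'a) (t :: 'a).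
    fin_digraph G \<and> (\<forall>e\<in>arcs G. 0 < c e) \<and> s \<in> verts G \<and> t \<in> verts G \<and> s \<noteq> t \<longrightarrow>
    (\<exists>S :: 'a set pair_pre_digraph set.
       finite S \<and>
       card S \<le> K * card (verts G) \<and>
       (\<Sum>D\<in>S. dag_size D) \<le> K * (card (arcs G) * card (verts G)) \<and>
       (\<forall>D\<in>S. partition_dag G s t D) \<and>
       (\<forall>e. vital G c s t e \<longrightarrow>
          (\<exists>Ds\<in>S. \<exists>Dt\<in>S.
             (\<forall>C. mincut_for G c s t e C \<longrightarrow> stores Ds C \<or> stores Dt C) \<and>
             (\<forall>C. st_cut G s t C \<longrightarrow>
                (mincut_for G c s t e C \<longleftrightarrow>
                 (one_transversal_cut Ds s t C \<or> one_transversal_cut Dt s t C) \<and>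
                 e \<in> contributing G C)))))"
proof (intro exI[of _ 24] allI impI)
  fix G :: "('a, 'b) pre_digraph" and c :: "'b \<Rightarrow> real" and s t :: 'a
  assume "fin_digraph G \<and> (\<forall>e\<in>arcs G. 0 < c e) \<and> s \<in> verts G \<and> t \<in> verts G \<and> s \<noteq> t"
  then interpret st_network G c s t
    by (auto simp: st_network_def st_network_axioms_def)
  show "\<exists>S. finite S \<and> card S \<le> 24 * card (verts G) \<and>
       (\<Sum>D\<in>S. dag_size D) \<le> 24 * (card (arcs G) * card (verts G)) \<and>
       (\<forall>D\<in>S. partition_dag G s t D) \<and>
       (\<forall>e. vital G c s t e \<longrightarrow>
          (\<exists>Ds\<in>S. \<exists>Dt\<in>S.
             (\<forall>C. mincut_for G c s t e C \<longrightarrow> stores Ds C \<or> stores Dt C) \<and>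
             (\<forall>C. st_cut G s t C \<longrightarrow>
                (mincut_for G c s t e C \<longleftrightarrow>
                 (one_transversal_cut Ds s t C \<or> one_transversal_cut Dt s t C) \<and>
                 e \<in> contributing G C))))"
    using exists_structure unfolding represents_mincuts_def .
qed

end
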